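(* Let $\beta>0$ and let $c(x,y)=V(y)-V(x)$, $(x,y)\in G$, be a separable cocycle, where $V:X\to\mathbb{R}$ is $\alpha$-Hölder for some $\alpha>0$. Suppose that the representation $\psi$ of $\sim$ is Lipschitz with $$\max_{i,j}\mathrm{Lip}\big(x\mapsto\psi_i(j*x)\big)<1 .$$ Let $$B_R(f)(x)=\sum_{j=1}^d\sum_{i=1}^{k_j} e^{-\beta V(\psi_i(j*x))}f(\psi_i(j*x)),$$ let $K\subset X$ be the attractor of the maps $x\mapsto\psi_i(j*x)$, let $\rho$ be the spectral radius of $B_R$ restricted to $C(K)$, and let $\mu$ be the unique Borel probability measure supported on $K$ with $B_R^*(\mu)=\rho\mu$. Then $M=\mu$ is $(c,\beta)$-quasi-invariant, that is, $$\int_X\sum_{s\in[x]} h(s,x)\,dM(x)=\int_X\sum_{s\in[x]} h(x,s)\,e^{-\beta (V(s)-V(x))}\,dM(x)$$ for every integrable function $h:G\to\mathbb{R}$.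
   Context: Let $d\ge 1$ be an integer and $X=\{1,\dots,d\}^{\mathbb{N}}$, a compact metric space with the usual metric $d_X(x,z)=2^{-\min\{n\ge1:\ x_n\ne z_n\}}$ ($d_X(x,x)=0$). For $j\in\{1,\dots,d\}$ and $x=(x_1,x_2,\dots)\in X$ write $j*x=(j,x_1,x_2,\dots)$. Let $\sim$ be an equivalence relation on $X$ with finite classes $[x]=\{s\in X: s\sim x\}$, such that $x\mapsto[x]$ is hemicontinuous as a multivalued map. Let $G=\{(x,y)\in X^2: x\sim y\}$ with the topology induced from $X^2$. For each $x$, $\nu^x$ denotes the counting measure on $[x]$. A representation $\psi$ of $\sim$: the elements of each class $[y]$ are listed (each exactly once) as an ordered tuple $(\psi_1(y),\dots,\psi_k(y))$, $k=\sharp[y]$, where this ordered list depends only on the class $[y]$. The representation is Lipschitz if for each $j$ the cardinality $k_j=\sharp[j*x]$ does not depend on $x\in X$, and all maps $x\mapsto\psi_i(j*x)$ ($1\le j\le d$, $1\le i\le k_j$) are Lipschitz on $X$; $\mathrm{Lip}$ denotes the Lipschitz constant with respect to $d_X$. The attractor $K$ of the finite family of contractions $\tau_{ij}(x)=\psi_i(j*x)$ is the unique nonempty compact set with $K=\bigcup_{i,j}\tau_{ij}(K)$. $B_R$ acts on $C(K)$, and $B_R^*$ is its dual, acting on finite Borel measures on $K$ by $\int f\,d(B_R^*\mu)=\int B_R(f)\,d\mu$. By a known theorem of Fan and Lau on Ruelle operators for contractive iterated function systems with Dini continuous weights, there is a unique probability $\mu$ on $K$ with $B_R^*\mu=\rho\mu$;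 it is regarded as a measure on $X$. In the quasi-invariance condition, "integrable $h$" means a Borel function $h$ for which both double integrals converge absolutely. *)

theory Defs
  imports "HOL-Probability.Probability" "HOL-Library.Stream"
begin

text \<open>
  The space of sequences over an alphabet with \<open>d\<close> letters is the type \<open>'d stream\<close> with
  \<open>'d :: finite\<close> and \<open>d = CARD('d)\<close>; \<open>j * x\<close> is \<open>j ## x\<close>. Positions in a stream are counted from 0
  by \<open>!!\<close> but from 1 in the formula for the metric, whence the successor in the exponent.
\<close>

instantiation stream :: (type) metric_space
begin

definition dist_stream :: "'a stream \<Rightarrow> 'a stream \<Rightarrow> real" where
  "dist_stream x z = (if x = z then 0 else (1 / 2) ^ Suc (LEAST n. x !! n \<noteq> z !! n))"

definition uniformity_stream :: "('a stream \<times> 'a stream) filter" where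
  "uniformity_stream = (INF e\<in>{0<..}. principal {(x, y). dist x y < e})"

definition open_stream :: "'a stream set \<Rightarrow> bool" where
  "open_stream U \<longleftrightarrow> (\<forall>x\<in>U. eventually (\<lambda>(x', y). x' = x \<longrightarrow> y \<in> U) uniformity)"

instance
proof
  fix x y z :: "'a stream"
  show "dist x y = 0 \<longleftrightarrow> x = y"
    by (simp add: dist_stream_def)
  have nonneg: "0 \<le> dist u v" for u v :: "'a stream"
    by (simp add: dist_stream_def)
  have separated: "dist x y \<le> dist u v" if "u \<noteq> v" "u !! n \<noteq> v !! n" "n = (LEAST n. x !! n \<noteq> y !! n)"
    for u v :: "'a stream" and n
  proof -
    have "(LEAST n. u !! n \<noteq> v !! n) \<le> n"
      using that(2) by (rule Least_le)
    then have "(1 / 2 :: real) ^ Suc n \<le> (1 / 2) ^ Suc (LEAST n. u !! n \<noteq> v !! n)"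
      by (intro power_decreasing) simp_all
    then show ?thesis
      using that(1) nonneg[of u v] unfolding dist_stream_def that(3)[symmetric] by simp
  qed
  show "dist x y \<le> dist x z + dist y z"
  proof (cases "x = y")
    case True
    then show ?thesis
      using nonneg[of x z] by (simp add: dist_stream_def)
  next
    case False
    define n where "n = (LEAST n. x !! n \<noteq> y !! n)"
    have "\<exists>n. x !! n \<noteq> y !! n"
      using False smap_alt[of id x y] by (metis id_apply stream.map_id)
    then have "x !! n \<noteq> y !! n"
      unfolding n_def by (rule LeastI_ex)
    then consider "x !! n \<noteq> z !! n" | "y !! n \<noteq> z !! n"
      by metis
    then show ?thesis
    proof cases
      case 1
      then have "dist x y \<le> dist x z"
        by (intro separated[OF _ _ n_def]) auto
      then show ?thesis
        using nonneg[of y z] by linarith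
    next
      case 2
      then have "dist x y \<le> dist y z"
        by (intro separated[OF _ _ n_def]) auto
      then show ?thesis
        using nonneg[of x z] by linarith
    qed
  qed
qed (simp_all only: uniformity_stream_def open_stream_def)

end

text \<open>The equivalence relation is its graph \<open>G\<close>, and the class of \<open>x\<close> is \<open>G `` {x}\<close>.\<close>

definition upper_hemicontinuous :: "('a::topological_space \<Rightarrow> 'b::topological_space set) \<Rightarrow> bool" where
  "upper_hemicontinuous F \<longleftrightarrow> (\<forall>U. open U \<longrightarrow> open {x. F x \<subseteq> U})"

definition lower_hemicontinuous :: "('a::topological_space \<Rightarrow> 'b::topological_space set) \<Rightarrow> bool" where
  "lower_hemicontinuous F \<longleftrightarrow> (\<forall>U. open U \<longrightarrow> open {x. F x \<inter> U \<noteq> {}})"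

definition hemicontinuous :: "('a::topological_space \<Rightarrow> 'b::topological_space set) \<Rightarrow> bool" where
  "hemicontinuous F \<longleftrightarrow> upper_hemicontinuous F \<and> lower_hemicontinuous F"

definition hoelder :: "real \<Rightarrow> ('a::metric_space \<Rightarrow> real) \<Rightarrow> bool" where
  "hoelder \<alpha> V \<longleftrightarrow> (\<exists>C. \<forall>x y. \<bar>V x - V y\<bar> \<le> C * dist x y powr \<alpha>)"

definition Lip :: "('a::metric_space \<Rightarrow> 'b::metric_space) \<Rightarrow> real" where
  "Lip f = Inf {L. L-lipschitz_on UNIV f}"

definition representation :: "('a \<times> 'a) set \<Rightarrow> ('a \<Rightarrow> 'a list) \<Rightarrow> bool" where
  "representation G \<psi> \<longleftrightarrow>
     (\<forall>y. distinct (\<psi> y) \<and> set (\<psi> y) = G `` {y}) \<and> (\<forall>(x, y)\<in>G. \<psi> x = \<psi> y)"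

text \<open>\<open>branch \<psi> j i\<close> is \<open>x \<mapsto> \<psi>\<^sub>i\<^sub>+\<^sub>1(j * x)\<close>: list positions start at 0, so \<open>i\<close> ranges over \<open>{..<k j}\<close>.\<close>

definition branch :: "('d stream \<Rightarrow> 'd stream list) \<Rightarrow> 'd \<Rightarrow> nat \<Rightarrow> 'd stream \<Rightarrow> 'd stream" where
  "branch \<psi> j i x = \<psi> (j ## x) ! i"

definition lipschitz_representation ::
    "('d stream \<times> 'd stream) set \<Rightarrow> ('d stream \<Rightarrow> 'd stream list) \<Rightarrow> ('d \<Rightarrow> nat) \<Rightarrow> bool" where
  "lipschitz_representation G \<psi> k \<longleftrightarrow>
     representation G \<psi> \<and>
     (\<forall>j x. card (G `` {j ## x}) = k j) \<and>
     (\<forall>j. \<forall>i<k j. \<exists>L. L-lipschitz_on UNIV (branch \<psi> j i))"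

definition attractor :: "('d stream \<Rightarrow> 'd stream list) \<Rightarrow> ('d \<Rightarrow> nat) \<Rightarrow> 'd stream set \<Rightarrow> bool" where
  "attractor \<psi> k K \<longleftrightarrow> K \<noteq> {} \<and> compact K \<and> K = (\<Union>j. \<Union>i<k j. branch \<psi> j i ` K)"

text \<open>The values of \<open>f\<close> may be real or complex: the dual is tested on real functions, whereas the
  spectrum requires complex scalars.\<close>

definition ruelle_op ::
    "('d::finite stream \<Rightarrow> 'd stream list) \<Rightarrow> ('d \<Rightarrow> nat) \<Rightarrow> real \<Rightarrow> ('d stream \<Rightarrow> real) \<Rightarrow>
     ('d stream \<Rightarrow> 'b::real_vector) \<Rightarrow> 'd stream \<Rightarrow> 'b" where
  "ruelle_op \<psi> k \<beta> V f x =
     (\<Sum>j\<in>UNIV. \<Sum>i<k j. exp (- \<beta> * V (branch \<psi> j i x)) *\<^sub>R f (branch \<psi> j i x))"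

text \<open>The complex Banach space \<open>C(K)\<close> for compact nonempty \<open>K\<close>; a function on \<open>K\<close> is given the value
  \<open>undefined\<close> off \<open>K\<close>, so that equality of functions is equality on \<open>K\<close>.\<close>

definition C_on :: "'a::topological_space set \<Rightarrow> ('a \<Rightarrow> complex) set" where
  "C_on K = {f \<in> extensional K. continuous_on K f}"

definition sup_norm :: "'a set \<Rightarrow> ('a \<Rightarrow> complex) \<Rightarrow> real" where
  "sup_norm K f = (SUP x\<in>K. norm (f x))"

definition bounded_op :: "'a::topological_space set \<Rightarrow> (('a \<Rightarrow> complex) \<Rightarrow> ('a \<Rightarrow> complex)) \<Rightarrow> bool" where
  "bounded_op K T \<longleftrightarrow>
     T \<in> C_on K \<rightarrow> C_on K \<and>
     (\<forall>f\<in>C_on K. \<forall>g\<in>C_on K. \<forall>x\<in>K. T (\<lambda>y\<in>K. f y + g y) x = T f x + T g x) \<and>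
     (\<forall>a. \<forall>f\<in>C_on K. \<forall>x\<in>K. T (\<lambda>y\<in>K. a * f y) x = a * T f x) \<and>
     (\<exists>B. \<forall>f\<in>C_on K. sup_norm K (T f) \<le> B * sup_norm K f)"

definition op_spectrum ::
    "'a::topological_space set \<Rightarrow> (('a \<Rightarrow> complex) \<Rightarrow> ('a \<Rightarrow> complex)) \<Rightarrow> complex set" where
  "op_spectrum K T =
     {z. \<not> (\<exists>S. bounded_op K S \<and>
            (\<forall>f\<in>C_on K. S (\<lambda>x\<in>K. z * f x - T f x) = f \<and> (\<lambda>x\<in>K. z * S f x - T (S f) x) = f))}"

definition op_spectral_radius ::
    "'a::topological_space set \<Rightarrow> (('a \<Rightarrow> complex) \<Rightarrow> ('a \<Rightarrow> complex)) \<Rightarrow> real" where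
  "op_spectral_radius K T = (SUP z\<in>op_spectrum K T. cmod z)"

text \<open>\<open>M\<close> is a Borel probability measure carried by \<open>K\<close> whose image under the dual of \<open>T\<close> is \<open>\<rho> M\<close>.
  Functions in \<open>C(K)\<close> are arbitrary off \<open>K\<close> here, so the integrals are taken over \<open>K\<close>.\<close>

definition dual_eigenprobability ::
    "'a::topological_space set \<Rightarrow> (('a \<Rightarrow> real) \<Rightarrow> ('a \<Rightarrow> real)) \<Rightarrow> real \<Rightarrow> 'a measure \<Rightarrow> bool" where
  "dual_eigenprobability K T \<rho> M \<longleftrightarrow>
     prob_space M \<and> sets M = sets borel \<and> emeasure M (- K) = 0 \<and>
     (\<forall>f. continuous_on K f \<longrightarrow>
        set_lebesgue_integral M K (T f) = \<rho> * set_lebesgue_integral M K f)"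

definition quasi_invariant ::
    "('a::topological_space \<times> 'a) set \<Rightarrow> ('a \<times> 'a \<Rightarrow> real) \<Rightarrow> real \<Rightarrow> 'a measure \<Rightarrow> bool" where
  "quasi_invariant G c \<beta> M \<longleftrightarrow>
     (\<forall>h :: 'a \<times> 'a \<Rightarrow> real.
        h \<in> borel_measurable (restrict_space borel G) \<longrightarrow>
        integrable M (\<lambda>x. \<Sum>s\<in>G `` {x}. \<bar>h (s, x)\<bar>) \<longrightarrow>
        integrable M (\<lambda>x. \<Sum>s\<in>G `` {x}. \<bar>h (x, s) * exp (- \<beta> * c (x, s))\<bar>) \<longrightarrow>
        (\<integral>x. (\<Sum>s\<in>G `` {x}. h (s, x)) \<partial>M) =
        (\<integral>x. (\<Sum>s\<in>G `` {x}. h (x, s) * exp (- \<beta> * c (x, s))) \<partial>M))"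

end

theory Submission
  imports Defs
begin

text \<open>
  The eigenmeasure identity \<open>\<integral> B f d\<mu> = \<rho> \<integral> f d\<mu>\<close>, given for continuous \<open>f\<close>, says that two finite Borel
  measures agree, so it holds for every integrable \<open>f\<close>; testing \<open>f = 1\<close> shows \<open>\<rho> > 0\<close>. The branches over
  \<open>j\<close> run through the class of \<open>j * x\<close>, so \<open>B\<close> sends both class sums in the quasi-invariance condition
  to the same function, a double sum over pairs in a common class. Dividing by \<open>\<rho>\<close> gives the claim.
\<close>

section \<open>Eigenmeasure identity for integrable functions\<close>

text \<open>Closed sets form an intersection-stable generator of the Borel sets, and the indicator
  of a closed set is a pointwise limit of continuous functions with values in [0, 1], so dominated
  convergence applies. The bound 1 keeps the test functions integrable against every finite
  measure.\<close>

lemma finite_measure_eqI_continuous: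
  fixes M N :: "'a::metric_space measure"
  assumes "finite_measure M" "finite_measure N" "sets M = sets borel" "sets N = sets borel"
    and eq: "\<And>f :: 'a \<Rightarrow> real. continuous_on UNIV f \<Longrightarrow> (\<And>x. \<bar>f x\<bar> \<le> 1) \<Longrightarrow> (\<integral>x. f x \<partial>M) = (\<integral>x. f x \<partial>N)"
  shows "M = N"
proof (rule measure_eqI_generator_eq[where E = "Collect closed" and \<Omega> = UNIV and A = "\<lambda>_. UNIV"])
  interpret M: finite_measure M by fact
  interpret N: finite_measure N by fact
  show "Int_stable (Collect closed :: 'a set set)"
    by (auto simp: Int_stable_def)
  have borel: "sets borel = sigma_sets UNIV (Collect closed :: 'a set set)"
    by (simp add: borel_eq_closed)
  show "sets M = sigma_sets UNIV (Collect closed)" "sets N = sigma_sets UNIV (Collect closed)"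
    using assms(3,4) borel by auto
  fix C :: "'a set"
  assume "C \<in> Collect closed"
  then have C: "closed C" by simp
  show "emeasure M C = emeasure N C"
  proof (cases "C = {}")
    case False
    \<comment> \<open>The value is 1 on \<open>C\<close>, and off \<open>C\<close> it is 0 once
      \<open>n\<close> reaches \<open>1 / infdist x C\<close>. The empty set is split off because
      \<open>infdist\<close> to it is 0 by convention, which would make \<open>f n\<close>
      constantly 1.\<close>
    define f where "f n x = max 0 (1 - real n * infdist x C)" for n x
    have f_cont: "continuous_on UNIV (f n)" for n
      unfolding f_def by (intro continuous_intros)
    have f_bound: "\<bar>f n x\<bar> \<le> 1" for n x
      by (simp add: f_def infdist_nonneg)
    have f_lim: "(\<lambda>n. f n x) \<longlonglongrightarrow> indicator C x" for x
    proof (cases "x \<in> C")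
      case False
      then have "infdist x C > 0"
        using C \<open>C \<noteq> {}\<close> infdist_pos_not_in_closed by metis
      moreover from this have "\<forall>\<^sub>F n in sequentially. 1 / infdist x C \<le> real n"
        by (intro filterlim_real_sequentially[THEN filterlim_at_top[THEN iffD1, rule_format]])
      ultimately have "\<forall>\<^sub>F n in sequentially. f n x = 0"
        by (auto simp: f_def field_simps elim!: eventually_mono)
      then show ?thesis
        using False by (simp add: tendsto_eventually)
    qed (simp add: f_def)
    have lim: "(\<lambda>n. \<integral>x. f n x \<partial>L) \<longlonglongrightarrow> measure L C"
      if L: "finite_measure L" "sets L = sets borel" for L
    proof -
      interpret finite_measure L by fact
      have "(\<lambda>n. \<integral>x. f n x \<partial>L) \<longlonglongrightarrow> (\<integral>x. indicator C x \<partial>L)"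
      proof (rule integral_dominated_convergence[where w = "\<lambda>_. 1"])
        show "indicator C \<in> borel_measurable L"
          using C L(2) by (intro borel_measurable_indicator) simp
        show "f n \<in> borel_measurable L" for n
          using borel_measurable_continuous_onI[OF f_cont] L(2) measurable_cong_sets by blast
      qed (use f_lim f_bound in auto)
      then show ?thesis
        using sets_eq_imp_space_eq[OF L(2)] by simp
    qed
    have "measure M C = measure N C"
      using lim[of M] lim[of N] eq[OF f_cont f_bound] assms LIMSEQ_unique by fastforce
    then show ?thesis
      by (simp add: M.emeasure_eq_measure N.emeasure_eq_measure)
  qed simp
qed (auto simp: finite_measure.emeasure_finite[OF assms(1)])

text \<open>Both sides integrate \<open>f\<close> against a finite Borel measure: the right one
  against \<open>\<rho>\<close> times \<open>M\<close>, the left one against the image of a weighted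
  product measure. By \<open>eig\<close> these agree on continuous functions, hence are equal, which
  covers every integrable \<open>f\<close>.\<close>

lemma transfer_operator_integral:
  fixes \<tau> :: "'i \<Rightarrow> 'a::metric_space \<Rightarrow> 'a" and w :: "'i \<Rightarrow> 'a \<Rightarrow> real"
  assumes I: "finite I"
    and M: "finite_measure M" "sets M = sets borel"
    and \<tau>: "\<And>i. i \<in> I \<Longrightarrow> continuous_on UNIV (\<tau> i)"
    and w: "\<And>i. i \<in> I \<Longrightarrow> continuous_on UNIV (w i)" "\<And>i x. i \<in> I \<Longrightarrow> 0 \<le> w i x"
      "\<And>i x. i \<in> I \<Longrightarrow> w i x \<le> B"
    and eig: "\<And>f. continuous_on UNIV f \<Longrightarrow> (\<integral>x. (\<Sum>i\<in>I. w i x * f (\<tau> i x)) \<partial>M) = \<rho> * (\<integral>x. f x \<partial>M)"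
    and "0 \<le> \<rho>"
    and f: "integrable M f"
  shows "(\<integral>x. (\<Sum>i\<in>I. w i x * f (\<tau> i x)) \<partial>M) = \<rho> * (\<integral>x. f x \<partial>M)"
proof -
  interpret M: finite_measure M by fact
  have space_M: "space M = UNIV"
    using sets_eq_imp_space_eq[OF M(2)] by simp
  interpret count: finite_measure "count_space I"
    by (rule finite_measure_count_space) fact
  interpret pair_sigma_finite "count_space I" M ..
  define P where "P = count_space I \<Otimes>\<^sub>M M"
  interpret P: finite_measure P
    unfolding P_def by (rule finite_measure_pair_measure) unfold_locales
  have space_P: "space P = I \<times> UNIV"
    by (simp add: P_def space_pair_measure space_M)
  \<comment> \<open>The index set is finite, so joint measurability reduces to that of the sections
    \<open>\<tau> i\<close> and \<open>w i\<close>, which are continuous.\<close>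
  have [measurable]: "case_prod \<tau> \<in> measurable P borel" "case_prod w \<in> borel_measurable P"
    unfolding P_def using \<tau> w(1) I measurable_cong_sets[OF M(2) refl]
    by (auto intro!: measurable_pair_measure_countable1 borel_measurable_continuous_onI
        simp: countable_finite)
  have w_int: "integrable P (case_prod w)"
    by (rule P.integrable_const_bound[where B = B]) (use w in \<open>auto simp: space_P\<close>)
  \<comment> \<open>This is the dual operator applied to \<open>M\<close>: each pair
    \<open>(i, x)\<close> is weighted by \<open>w i x\<close> and pushed to
    \<open>\<tau> i x\<close>. The bound \<open>B\<close> makes \<open>N\<close> finite, and Fubini
    turns integrals against \<open>N\<close> into integrals of sums over \<open>I\<close>.\<close>
  define N where "N = distr (density P (case_prod w)) borel (case_prod \<tau>)"
  have w_nonneg: "AE z in P. 0 \<le> case_prod w z"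
    using w(2) by (auto simp: space_P)
  have "finite_measure (density P (case_prod w))"
  proof (rule finite_measureI)
    have "(\<integral>\<^sup>+ z. ennreal (case_prod w z) \<partial>P) < \<infinity>"
      using w_int w_nonneg by (simp add: nn_integral_eq_integral)
    then show "emeasure (density P (case_prod w)) (space (density P (case_prod w))) \<noteq> \<infinity>"
      by (simp add: emeasure_density cong: nn_integral_cong)
  qed
  then have N: "finite_measure N"
    unfolding N_def by (intro finite_measure.finite_measure_distr) simp_all
  have N_integral: "(\<integral>x. g x \<partial>N) = (\<integral>x. (\<Sum>i\<in>I. w i x * g (\<tau> i x)) \<partial>M)"
    if g: "integrable N g" for g :: "'a \<Rightarrow> real"
  proof -
    have [measurable]: "g \<in> borel_measurable borel"
      using borel_measurable_integrable[OF g] by (simp add: N_def)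
    have "integrable P (\<lambda>z. case_prod w z * g (case_prod \<tau> z))"
      using g w_nonneg by (simp add: N_def integrable_distr_eq integrable_density)
    then have "integrable (count_space I \<Otimes>\<^sub>M M) (\<lambda>(i, x). w i x * g (\<tau> i x))"
      by (simp add: P_def case_prod_beta')
    from integral_snd[OF this]
    have "(\<integral>x. (\<integral>i. w i x * g (\<tau> i x) \<partial>count_space I) \<partial>M)
        = (\<integral>z. case_prod w z * g (case_prod \<tau> z) \<partial>P)"
      by (simp add: P_def case_prod_beta')
    also have "\<dots> = (\<integral>x. g x \<partial>N)"
      using w_nonneg by (simp add: N_def integral_distr integral_density)
    finally show ?thesis
      using I by (simp add: lebesgue_integral_count_space_finite)
  qed
  have scale: "(\<integral>x. g x \<partial>density M (\<lambda>_. \<rho>)) = \<rho> * (\<integral>x. g x \<partial>M)"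
    if "g \<in> borel_measurable M" for g :: "'a \<Rightarrow> real"
    using that \<open>0 \<le> \<rho>\<close> by (simp add: integral_density)
  have "density M (\<lambda>_. \<rho>) = N"
  proof (rule finite_measure_eqI_continuous)
    show "finite_measure (density M (\<lambda>_. ennreal \<rho>))"
      by (rule finite_measureI) (simp add: emeasure_density ennreal_mult_eq_top_iff)
    show "sets (density M (\<lambda>_. ennreal \<rho>)) = sets borel" "sets N = sets borel"
      using M(2) by (simp_all add: N_def)
    fix g :: "'a \<Rightarrow> real"
    assume g: "continuous_on UNIV g" "\<And>x. \<bar>g x\<bar> \<le> 1"
    have g': "g \<in> borel_measurable borel"
      by (rule borel_measurable_continuous_onI) fact
    then have "integrable N g"
      using g(2) by (intro finite_measure.integrable_const_bound[OF N, where B = 1]) (auto simp: N_def)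
    then show "(\<integral>x. g x \<partial>density M (\<lambda>_. \<rho>)) = (\<integral>x. g x \<partial>N)"
      using g' scale[of g] eig[OF g(1)] by (simp add: N_integral measurable_cong_sets[OF M(2) refl])
  qed (rule N)
  \<comment> \<open>Through the equality of the measures, \<open>f\<close> is integrable against
    \<open>N\<close> too, as \<open>N_integral\<close> demands.\<close>
  moreover have "integrable (density M (\<lambda>_. \<rho>)) f"
    using f \<open>0 \<le> \<rho>\<close> by (simp add: integrable_density)
  ultimately show ?thesis
    using N_integral[of f] scale[of f] f by simp
qed

section \<open>Sequence space and Hoelder functions\<close>

lemma dist_stream_le: "dist (x :: 'a stream) y \<le> 1 / 2"
  by (simp add: dist_stream_def power_le_one)

lemma ex_snth_neq: "x \<noteq> y \<Longrightarrow> \<exists>n. x !! n \<noteq> y !! n"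
  using smap_alt[of id x y] by (metis id_apply stream.map_id)

lemma dist_stream_Cons: "dist (a ## x) (a ## y) = dist x y / 2"
proof (cases "x = y")
  case False
  then obtain n where "x !! n \<noteq> y !! n"
    using ex_snth_neq by blast
  then have "(LEAST n. (a ## x) !! n \<noteq> (a ## y) !! n) = Suc (LEAST n. x !! n \<noteq> y !! n)"
    by (intro Least_Suc2[of _ "Suc n" _ n]) auto
  then show ?thesis
    using False by (simp add: dist_stream_def)
qed (simp add: dist_stream_def)

lemma shd_eq_if_dist_less: "dist x y < 1 / 2 \<Longrightarrow> shd x = shd y"
  by (rule ccontr) (auto simp: dist_stream_def Least_eq_0 split: if_splits)

lemma continuous_on_SCons: "continuous_on S (\<lambda>x :: 'a stream. a ## x)"
proof -
  have "(1 / 2)-lipschitz_on S (\<lambda>x :: 'a stream. a ## x)"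
    by (intro lipschitz_onI) (auto simp: dist_stream_Cons)
  then show ?thesis
    by (rule lipschitz_on_continuous_on)
qed

lemma continuous_on_stl: "continuous_on S (stl :: 'a stream \<Rightarrow> _)"
proof -
  \<comment> \<open>With equal first letters this is an equality. Otherwise
    \<open>dist x y = 1 / 2\<close>, so the right side is 1, beyond any distance in the
    space.\<close>
  have "dist (stl x) (stl y) \<le> 2 * dist x y" for x y :: "'a stream"
  proof (cases "shd x = shd y")
    case True
    then show ?thesis
      using dist_stream_Cons[of "shd x" "stl x" "stl y"] stream.collapse[of x] stream.collapse[of y] by simp
  next
    case False
    then show ?thesis
      using shd_eq_if_dist_less[of x y] dist_stream_le[of "stl x" "stl y"] by fastforce
  qed
  then have "2-lipschitz_on S (stl :: 'a stream \<Rightarrow> _)"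
    by (intro lipschitz_onI) auto
  then show ?thesis
    by (rule lipschitz_on_continuous_on)
qed

lemma open_shd_eq: "open {x :: 'a stream. shd x = a}"
  unfolding open_dist
proof (intro ballI exI conjI allI impI)
  fix x y :: "'a stream"
  assume "x \<in> {x. shd x = a}" "dist y x < 1 / 2"
  then show "y \<in> {x. shd x = a}"
    using shd_eq_if_dist_less[of y x] by simp
qed simp

text \<open>On the cylinder of sequences starting with \<open>a\<close>, \<open>f\<close> is
  \<open>\<lambda>x. f (a ## x)\<close> after the shift \<open>stl\<close>; the cylinders are open
  and finitely many. This serves the class sums, which are controlled one first letter at a
  time.\<close>

lemma borel_measurable_stream_cases:
  fixes f :: "'a::finite stream \<Rightarrow> real"
  assumes "\<And>a. (\<lambda>x. f (a ## x)) \<in> borel_measurable borel"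
  shows "f \<in> borel_measurable borel"
proof -
  have [measurable]: "stl \<in> borel_measurable (borel :: 'a stream measure)"
    by (intro borel_measurable_continuous_onI continuous_on_stl)
  have [measurable]: "{x :: 'a stream. shd x = a} \<in> sets borel" for a
    by (simp add: open_shd_eq)
  note [measurable] = assms
  have "(\<lambda>x. \<Sum>a\<in>UNIV. indicator {x. shd x = a} x * f (a ## stl x)) \<in> borel_measurable borel"
    by measurable
  moreover have "(\<Sum>a\<in>UNIV. indicator {x. shd x = a} x * f (a ## stl x)) = f x" for x
    by (subst sum.remove[of _ "shd x"]) (auto intro!: sum.neutral)
  ultimately show ?thesis
    by simp
qed

lemma hoelder_continuous_on:
  assumes "hoelder \<alpha> V" "\<alpha> > 0"
  shows "continuous_on S V"
  unfolding continuous_on_def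
proof
  fix x
  obtain C where C: "\<And>x y. \<bar>V x - V y\<bar> \<le> C * dist x y powr \<alpha>"
    using assms(1) by (auto simp: hoelder_def)
  have "((\<lambda>y. dist y x) \<longlongrightarrow> 0) (at x within S)"
    by (rule tendsto_dist_iff[THEN iffD1, OF tendsto_ident_at])
  then have "((\<lambda>y. C * dist y x powr \<alpha>) \<longlongrightarrow> C * 0 powr \<alpha>) (at x within S)"
    using assms(2) by (intro tendsto_mult tendsto_powr' tendsto_const) simp_all
  then have lim: "((\<lambda>y. C * dist y x powr \<alpha>) \<longlongrightarrow> 0) (at x within S)"
    by simp
  have "((\<lambda>y. V y - V x) \<longlongrightarrow> 0) (at x within S)"
    by (rule Lim_null_comparison[OF always_eventually lim]) (simp only: real_norm_def C simp_thms)
  then show "(V \<longlongrightarrow> V x) (at x within S)"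
    by (rule Lim_null[THEN iffD2])
qed

lemma hoelder_stream_bounded:
  fixes V :: "'a stream \<Rightarrow> real"
  assumes "hoelder \<alpha> V" "\<alpha> > 0"
  obtains B where "\<And>x. \<bar>V x\<bar> \<le> B"
proof -
  obtain C where C: "\<And>x y. \<bar>V x - V y\<bar> \<le> C * dist x y powr \<alpha>"
    using assms(1) by (auto simp: hoelder_def)
  \<comment> \<open>Any base point serves, as no distance exceeds 1/2. The absolute value of
    \<open>C\<close> is taken because \<open>hoelder\<close> does not prescribe the sign of
    \<open>C\<close>.\<close>
  have "\<bar>V x\<bar> \<le> \<bar>V (sconst undefined)\<bar> + \<bar>C\<bar>" for x
  proof -
    have "dist x (sconst undefined) powr \<alpha> \<le> 1"
      using dist_stream_le[of x "sconst undefined"] assms(2) by (intro powr_le1) auto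
    then have "C * dist x (sconst undefined) powr \<alpha> \<le> \<bar>C\<bar>"
      by (metis abs_ge_zero abs_mult abs_of_nonneg abs_ge_self mult_left_le order_trans powr_ge_zero)
    then show ?thesis
      using C[of x "sconst undefined"] by linarith
  qed
  then show thesis
    by (rule that)
qed

section \<open>Sums over equivalence classes\<close>

lemma representation_sum:
  assumes "representation G \<psi>"
  shows "(\<Sum>s\<in>G `` {y}. g s) = (\<Sum>i<card (G `` {y}). g (\<psi> y ! i))"
proof -
  have "distinct (\<psi> y)" "set (\<psi> y) = G `` {y}"
    using assms by (auto simp: representation_def)
  then have "bij_betw ((!) (\<psi> y)) {..<card (G `` {y})} (G `` {y})"
    by (metis bij_betw_nth distinct_card)
  then show ?thesis
    by (rule sum.reindex_bij_betw[symmetric])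
qed

lemma continuous_on_branch:
  assumes "lipschitz_representation G \<psi> k" "i < k j"
  shows "continuous_on UNIV (branch \<psi> j i)"
  using assms lipschitz_on_continuous_on unfolding lipschitz_representation_def by metis

text \<open>The class of \<open>j ## x\<close> is listed by \<open>k j\<close> continuous branches,
  a number independent of \<open>x\<close>. So for each first letter the class sum is a fixed finite
  sum of Borel functions.\<close>

lemma borel_measurable_class_sum:
  fixes G :: "('d::finite stream \<times> 'd stream) set"
  assumes "lipschitz_representation G \<psi> k"
    and q: "q \<in> borel_measurable (restrict_space borel G)"
  shows "(\<lambda>y. \<Sum>s\<in>G `` {y}. q (y, s) :: real) \<in> borel_measurable borel"
proof (rule borel_measurable_stream_cases)
  fix j
  have rep: "representation G \<psi>" and k: "\<And>x. card (G `` {j ## x}) = k j"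
    using assms(1) by (auto simp: lipschitz_representation_def)
  note cont = continuous_on_branch[OF assms(1)]
  have "(\<lambda>x. q (j ## x, branch \<psi> j i x)) \<in> borel_measurable borel" if "i < k j" for i
  proof -
    have "(\<lambda>x. (j ## x, branch \<psi> j i x)) \<in> borel_measurable borel"
      using that by (intro borel_measurable_continuous_onI continuous_on_Pair continuous_on_SCons cont)
    \<comment> \<open>\<open>q\<close> is measurable only on \<open>G\<close>, so the pair must stay
      there: \<open>branch \<psi> j i x\<close> is an entry of the list of the class of
      \<open>j ## x\<close>, whose length is \<open>k j\<close>.\<close>
    moreover have "(j ## x, branch \<psi> j i x) \<in> G" for x
    proof -
      have "set (\<psi> (j ## x)) = G `` {j ## x}" "length (\<psi> (j ## x)) = k j"
        using rep k[of x] distinct_card[of "\<psi> (j ## x)"] by (auto simp: representation_def)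
      then show ?thesis
        using that nth_mem[of i "\<psi> (j ## x)"] by (auto simp: branch_def)
    qed
    ultimately have "(\<lambda>x. (j ## x, branch \<psi> j i x)) \<in> measurable borel (restrict_space borel G)"
      by (intro measurable_restrict_space2) auto
    from measurable_compose[OF this q] show ?thesis .
  qed
  then have "(\<lambda>x. \<Sum>i<k j. q (j ## x, branch \<psi> j i x)) \<in> borel_measurable borel"
    by (intro borel_measurable_sum) auto
  then show "(\<lambda>x. \<Sum>s\<in>G `` {j ## x}. q (j ## x, s)) \<in> borel_measurable borel"
    by (simp add: representation_sum[OF rep] k branch_def)
qed

text \<open>For fixed \<open>j\<close> the branches meet each point of the class of
  \<open>j ## x\<close> exactly once, so the order chosen by \<open>\<psi>\<close> drops
  out.\<close>

lemma ruelle_op_eq_class_sum: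
  fixes f :: "'d::finite stream \<Rightarrow> real"
  assumes "lipschitz_representation G \<psi> k"
  shows "ruelle_op \<psi> k \<beta> V f x = (\<Sum>j\<in>UNIV. \<Sum>s\<in>G `` {j ## x}. exp (- \<beta> * V s) * f s)"
  using assms representation_sum[of G \<psi> "\<lambda>s. exp (- \<beta> * V s) * f s"]
  by (simp add: lipschitz_representation_def ruelle_op_def branch_def)

text \<open>After the weights \<open>exp (- \<beta> * V y)\<close> have been distributed, the two sides differ by the
  exchange of the two points, which range over the same class.\<close>

lemma ruelle_op_class_sums_eq:
  fixes h c :: "'d::finite stream \<times> 'd stream \<Rightarrow> real"
  assumes "equiv UNIV G" "lipschitz_representation G \<psi> k"
    and c: "\<forall>(x, y)\<in>G. c (x, y) = V y - V x"
  shows "ruelle_op \<psi> k \<beta> V (\<lambda>y. \<Sum>s\<in>G `` {y}. h (s, y)) x =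
    ruelle_op \<psi> k \<beta> V (\<lambda>y. \<Sum>s\<in>G `` {y}. h (y, s) * exp (- \<beta> * c (y, s))) x"
  unfolding ruelle_op_eq_class_sum[OF assms(2)]
proof (rule sum.cong[OF refl])
  fix j
  define C where "C = G `` {j ## x}"
  \<comment> \<open>Points of one class share that class, so the inner sum also runs over
    \<open>C\<close> and the two sums can be exchanged.\<close>
  have C: "G `` {y} = C" if "y \<in> C" for y
    using that equiv_class_eq[OF assms(1), of "j ## x" y] by (simp add: C_def)
  have "(\<Sum>y\<in>C. exp (- \<beta> * V y) * (\<Sum>s\<in>G `` {y}. h (s, y)))
      = (\<Sum>y\<in>C. \<Sum>s\<in>C. exp (- \<beta> * V y) * h (s, y))"
    by (simp add: C sum_distrib_left)
  also have "\<dots> = (\<Sum>y\<in>C. \<Sum>s\<in>C. exp (- \<beta> * V s) * h (y, s))"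
    by (rule sum.swap)
  also have "\<dots> = (\<Sum>y\<in>C. \<Sum>s\<in>C. exp (- \<beta> * V y) * (h (y, s) * exp (- \<beta> * c (y, s))))"
  proof (intro sum.cong refl)
    fix y s
    assume "y \<in> C" "s \<in> C"
    then have c_ys: "c (y, s) = V s - V y"
      using C[of y] c by auto
    have "- \<beta> * V s = - \<beta> * V y + - \<beta> * c (y, s)"
      unfolding c_ys by (simp add: algebra_simps)
    then show "exp (- \<beta> * V s) * h (y, s) = exp (- \<beta> * V y) * (h (y, s) * exp (- \<beta> * c (y, s)))"
      by (simp only: exp_add mult_ac)
  qed
  also have "\<dots> = (\<Sum>y\<in>C. exp (- \<beta> * V y) * (\<Sum>s\<in>G `` {y}. h (y, s) * exp (- \<beta> * c (y, s))))"
    by (simp add: C sum_distrib_left)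
  finally show "(\<Sum>y\<in>G `` {j ## x}. exp (- \<beta> * V y) * (\<Sum>s\<in>G `` {y}. h (s, y)))
      = (\<Sum>y\<in>G `` {j ## x}. exp (- \<beta> * V y) * (\<Sum>s\<in>G `` {y}. h (y, s) * exp (- \<beta> * c (y, s))))"
    by (simp only: C_def)
qed

section \<open>Quasi-invariance of the eigenmeasure\<close>

theorem theorem4p6:
  fixes G :: "('d::finite stream \<times> 'd stream) set"
    and \<psi> :: "'d stream \<Rightarrow> 'd stream list"
    and k :: "'d \<Rightarrow> nat"
    and V :: "'d stream \<Rightarrow> real"
    and c :: "'d stream \<times> 'd stream \<Rightarrow> real"
    and \<alpha> \<beta> :: real
    and K :: "'d stream set"
    and \<mu> :: "'d stream measure"
  assumes "equiv UNIV G"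
    and "\<forall>x. finite (G `` {x})"
    and "hemicontinuous (\<lambda>x. G `` {x})"
    and "\<beta> > 0"
    and "\<alpha> > 0"
    and "hoelder \<alpha> V"
    and "\<forall>(x, y)\<in>G. c (x, y) = V y - V x"
    and "lipschitz_representation G \<psi> k"
    and "Max {Lip (branch \<psi> j i) | j i. i < k j} < 1"
    and "attractor \<psi> k K"
    and "dual_eigenprobability K (ruelle_op \<psi> k \<beta> V)
           (op_spectral_radius K (\<lambda>f. restrict (ruelle_op \<psi> k \<beta> V f) K)) \<mu>"
  shows "quasi_invariant G c \<beta> \<mu>"
proof -
  \<comment> \<open>The spectral radius belongs to the complex operator, while the eigenmeasure is
    tested with the real one, \<open>?T\<close>.\<close>
  define \<rho> where "\<rho> = op_spectral_radius K
    (\<lambda>f :: 'd stream \<Rightarrow> complex. restrict (ruelle_op \<psi> k \<beta> V f) K)"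
  let ?T = "ruelle_op \<psi> k \<beta> V :: ('d stream \<Rightarrow> real) \<Rightarrow> _"
  have "prob_space \<mu>" and sets: "sets \<mu> = sets borel" and null: "emeasure \<mu> (- K) = 0"
    and eig: "\<And>f. continuous_on K f \<Longrightarrow>
        set_lebesgue_integral \<mu> K (?T f) = \<rho> * set_lebesgue_integral \<mu> K f"
    using assms(11) by (auto simp: dual_eigenprobability_def \<rho>_def)
  interpret prob_space \<mu> by fact
  have space: "space \<mu> = UNIV"
    using sets_eq_imp_space_eq[OF sets] by simp
  note meas = measurable_cong_sets[OF sets refl]
  have V: "continuous_on S V" for S
    using assms(5,6) by (rule hoelder_continuous_on[rotated])
  obtain B where B: "\<And>x. \<bar>V x\<bar> \<le> B"
    using hoelder_stream_bounded assms(5,6) by metis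
  note branch = continuous_on_branch[OF assms(8)]
  have V_branch: "continuous_on UNIV (\<lambda>x. V (branch \<psi> j i x))" if "i < k j" for j i
    using continuous_on_compose2[OF V branch[OF that]] by blast
  have T_cont: "continuous_on UNIV (?T f)" if "continuous_on UNIV f" for f
    unfolding ruelle_op_def
    by (intro continuous_intros V_branch continuous_on_compose2[OF that branch]) auto

  have K: "K \<in> sets \<mu>"
    using assms(10) sets by (auto simp: attractor_def compact_imp_closed)
  \<comment> \<open>Since \<open>\<mu>\<close> is carried by \<open>K\<close>, integrals over
    \<open>K\<close> become integrals over the whole space, where quasi-invariance is
    stated.\<close>
  have "AE x in \<mu>. x \<in> K"
    using null sets.compl_sets[OF K] by (intro AE_I[where N = "- K"]) (auto simp: space Compl_eq_Diff_UNIV)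
  then have on_K: "set_lebesgue_integral \<mu> K f = (\<integral>x. f x \<partial>\<mu>)" if "continuous_on UNIV f" for f :: "_ \<Rightarrow> real"
    unfolding set_lebesgue_integral_def
    using K borel_measurable_continuous_onI[OF that]
    by (intro integral_cong_AE) (auto simp: meas sets)
  have eigen: "(\<integral>x. ?T f x \<partial>\<mu>) = \<rho> * (\<integral>x. f x \<partial>\<mu>)" if "continuous_on UNIV f" for f
    using eig[of f] that T_cont[OF that] by (simp add: on_K continuous_on_subset[OF that])

  \<comment> \<open>The lower bound on the weights will give \<open>\<rho> > 0\<close>; the upper
    one keeps the operator bounded.\<close>
  let ?b = "exp (- (\<bar>\<beta>\<bar> * B))"
  have exp_bounds: "?b \<le> exp (- \<beta> * V x)" "exp (- \<beta> * V x) \<le> exp (\<bar>\<beta>\<bar> * B)" for x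
  proof -
    have "\<bar>\<beta> * V x\<bar> \<le> \<bar>\<beta>\<bar> * B"
      unfolding abs_mult by (intro mult_left_mono B) simp
    then show "?b \<le> exp (- \<beta> * V x)" "exp (- \<beta> * V x) \<le> exp (\<bar>\<beta>\<bar> * B)"
      unfolding exp_le_cancel_iff by linarith+
  qed
  have T_one: "?b \<le> ?T (\<lambda>_. 1) x" for x
  proof -
    \<comment> \<open>Any letter will do: \<open>?j ## x\<close> lies in its own class, and this
      single term of the nonnegative double sum is at least \<open>?b\<close>.\<close>
    let ?j = "undefined :: 'd"
    have "?j ## x \<in> G `` {?j ## x}"
      using equiv_class_self[OF assms(1)] by simp
    then have "exp (- \<beta> * V (?j ## x)) \<le> (\<Sum>s\<in>G `` {?j ## x}. exp (- \<beta> * V s))"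
      using assms(2) by (intro member_le_sum) auto
    also have "\<dots> \<le> (\<Sum>j\<in>UNIV. \<Sum>s\<in>G `` {j ## x}. exp (- \<beta> * V s))"
      by (intro member_le_sum[of ?j UNIV "\<lambda>j. \<Sum>s\<in>G `` {j ## x}. exp (- \<beta> * V s)"]) (auto intro: sum_nonneg)
    finally show ?thesis
      unfolding ruelle_op_eq_class_sum[OF assms(8)] mult_1_right by (rule order_trans[OF exp_bounds(1)])
  qed
  \<comment> \<open>As \<open>\<mu>\<close> has mass 1, the test function 1 gives
    \<open>\<rho>\<close> as the integral of \<open>?T (\<lambda>_. 1)\<close>, which is at least
    \<open>?b\<close>. The upper bound secures integrability.\<close>
  have \<rho>: "\<rho> > 0"
  proof -
    have upper: "?T (\<lambda>_. 1) x \<le> (\<Sum>j\<in>UNIV. \<Sum>i<k j. exp (\<bar>\<beta>\<bar> * B))" for x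
      unfolding ruelle_op_def using exp_bounds(2) by (intro sum_mono) simp
    have "0 \<le> ?T (\<lambda>_. 1) x" for x
      using order_trans[OF _ T_one] by simp
    then have "integrable \<mu> (?T (\<lambda>_. 1))"
      using upper borel_measurable_continuous_onI[OF T_cont[of "\<lambda>_. 1"]]
      by (intro integrable_const_bound) (auto simp: meas)
    then have "?b \<le> (\<integral>x. ?T (\<lambda>_. 1) x \<partial>\<mu>)"
      using T_one by (intro integral_ge_const) auto
    then have "?b \<le> \<rho>"
      using eigen[of "\<lambda>_. 1"] prob_space by simp
    then show ?thesis
      by (rule less_le_trans[OF exp_gt_zero])
  qed

  have T_integral: "(\<integral>x. ?T f x \<partial>\<mu>) = \<rho> * (\<integral>x. f x \<partial>\<mu>)" if f: "integrable \<mu> f" for f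
  proof -
    \<comment> \<open>The double sum over letters and list positions is flattened to one finite
      index set.\<close>
    define I where "I = (SIGMA j:(UNIV :: 'd set). {..<k j})"
    define \<tau> where "\<tau> = (\<lambda>(j, i). branch \<psi> j i)"
    have T: "?T g x = (\<Sum>z\<in>I. exp (- \<beta> * V (\<tau> z x)) * g (\<tau> z x))" for g x
      by (simp add: ruelle_op_def I_def \<tau>_def sum.Sigma case_prod_beta')
    show ?thesis
      unfolding T
    proof (rule transfer_operator_integral[where w = "\<lambda>z x. exp (- \<beta> * V (\<tau> z x))"])
      show "finite I"
        by (simp add: I_def)
      show "finite_measure \<mu>"
        by (rule finite_measure_axioms)
      show "continuous_on UNIV (\<tau> z)" "continuous_on UNIV (\<lambda>x. exp (- \<beta> * V (\<tau> z x)))" if "z \<in> I" for z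
        using that by (auto simp: I_def \<tau>_def intro!: continuous_intros branch V_branch)
      show "exp (- \<beta> * V (\<tau> z x)) \<le> exp (\<bar>\<beta>\<bar> * B)" for z x
        by (rule exp_bounds)
    qed (use sets f eigen \<rho> in \<open>simp_all add: T\<close>)
  qed

  show ?thesis
    unfolding quasi_invariant_def
  proof (intro allI impI)
    fix h :: "'d stream \<times> 'd stream \<Rightarrow> real"
    assume h: "h \<in> borel_measurable (restrict_space borel G)"
      and int1: "integrable \<mu> (\<lambda>x. \<Sum>s\<in>G `` {x}. \<bar>h (s, x)\<bar>)"
      and int2: "integrable \<mu> (\<lambda>x. \<Sum>s\<in>G `` {x}. \<bar>h (x, s) * exp (- \<beta> * c (x, s))\<bar>)"
    let ?L = "\<lambda>x. \<Sum>s\<in>G `` {x}. h (s, x)"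
    let ?R = "\<lambda>x. \<Sum>s\<in>G `` {x}. h (x, s) * exp (- \<beta> * c (x, s))"
    \<comment> \<open>\<open>h (s, x)\<close> has the summation variable first; by symmetry of
      \<open>G\<close> the swapped function is again measurable on \<open>G\<close>, so its class
      sum is Borel. Domination by \<open>int1\<close> then gives integrability.\<close>
    have "prod.swap \<in> measurable (restrict_space borel G) (restrict_space borel G)"
    proof (rule measurable_restrict_space2)
      show "prod.swap \<in> space (restrict_space borel G) \<rightarrow> G"
        using assms(1) by (auto simp: space_restrict_space equiv_def dest: symD)
      show "prod.swap \<in> borel_measurable (restrict_space borel G)"
        by (intro measurable_restrict_space1 borel_measurable_continuous_onI continuous_on_swap)
    qed
    from measurable_compose[OF this h]
    have "(\<lambda>z. h (prod.swap z)) \<in> borel_measurable (restrict_space borel G)" .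
    from borel_measurable_class_sum[OF assms(8) this]
    have L: "integrable \<mu> ?L"
      by (intro Bochner_Integration.integrable_bound[OF int1]) (auto simp: meas intro: order_trans[OF sum_abs] abs_ge_self)
    \<comment> \<open>\<open>c\<close> is known only on \<open>G\<close>, so measurability is shown
      for the continuous expression in \<open>V\<close> that agrees with it there.\<close>
    have V1: "(\<lambda>z. exp (- \<beta> * (V (snd z) - V (fst z)))) \<in> borel_measurable (restrict_space borel G)"
      by (intro measurable_restrict_space1 borel_measurable_continuous_onI continuous_intros
          continuous_on_compose2[OF V]) auto
    have "(\<lambda>z. h z * exp (- \<beta> * (V (snd z) - V (fst z)))) \<in> borel_measurable (restrict_space borel G)"
      using h V1 by (rule borel_measurable_times)
    from borel_measurable_class_sum[OF assms(8) this]
    have "(\<lambda>x. \<Sum>s\<in>G `` {x}. h (x, s) * exp (- \<beta> * (V s - V x))) \<in> borel_measurable borel"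
      by simp
    moreover have "(\<lambda>x. \<Sum>s\<in>G `` {x}. h (x, s) * exp (- \<beta> * (V s - V x))) = ?R"
      using assms(7) by (intro ext sum.cong) auto
    ultimately have R: "integrable \<mu> ?R"
      by (intro Bochner_Integration.integrable_bound[OF int2]) (auto simp: meas intro: order_trans[OF sum_abs] abs_ge_self)
    \<comment> \<open>The class sums are merely integrable, which is why \<open>T_integral\<close>
      is used and not \<open>eigen\<close>.\<close>
    have "\<rho> * (\<integral>x. ?L x \<partial>\<mu>) = (\<integral>x. ?T ?L x \<partial>\<mu>)"
      by (rule T_integral[OF L, symmetric])
    also have "\<dots> = (\<integral>x. ?T ?R x \<partial>\<mu>)"
      by (simp only: ruelle_op_class_sums_eq[OF assms(1,8,7)])
    also have "\<dots> = \<rho> * (\<integral>x. ?R x \<partial>\<mu>)"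
      by (rule T_integral[OF R])
    finally show "(\<integral>x. ?L x \<partial>\<mu>) = (\<integral>x. ?R x \<partial>\<mu>)"
      using \<rho> by simp
  qed
qed

end
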